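(* Let $N_l, N_u, d$ be positive integers, let $\mathbf{X} \in \mathbb{R}^{N_l \times d}$, $\mathbf{X}_{\mathrm{u}} \in \mathbb{R}^{N_u \times d}$, $\mathbf{y} \in \{0,1\}^{N_l}$, and let $\mathbf{X}_{\mathrm{e}} = \begin{bmatrix} \mathbf{X} \\ \mathbf{X}_{\mathrm{u}} \end{bmatrix} \in \mathbb{R}^{(N_l+N_u)\times d}$. Assume that $\mathbf{X}_{\mathrm{e}}^\top \mathbf{X}_{\mathrm{e}}$ is positive definite and that $\mathbf{X}^\top\mathbf{X}$ is invertible, and let $$\mathbf{w}_{\mathrm{sup}} = (\mathbf{X}^\top \mathbf{X})^{-1}\mathbf{X}^\top \mathbf{y}.$$ Let $$\Theta = \left\{ (\mathbf{X}_{\mathrm{e}}^\top \mathbf{X}_{\mathrm{e}})^{-1} \mathbf{X}_{\mathrm{e}}^\top \begin{bmatrix} \mathbf{y} \\ \mathbf{y}_{\mathrm{u}} \end{bmatrix} \;\middle|\; \mathbf{y}_{\mathrm{u}} \in [0,1]^{N_u} \right\} \subset \mathbb{R}^d,$$ and let $\mathbf{w}_{\mathrm{semi}}$ be the projected estimator, i.e. the minimizer over $\mathbf{w} \in \Theta$ of $\mathrm{d}(\mathbf{w}, \mathbf{w}_{\mathrm{sup}})$, where $\mathrm{d}(\mathbf{w},\mathbf{w}') = \sqrt{(\mathbf{w}-\mathbf{w}')^\top \mathbf{X}_{\mathrm{e}}^\top \mathbf{X}_{\mathrm{e}} (\mathbf{w}-\mathbf{w}')}$. Then for every vector of true labels $\mathbf{y}_{\mathrm{u}}^{\ast}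 \in \{0,1\}^{N_u}$ of the unlabeled objects, with $\mathbf{y}_{\mathrm{e}}^{\ast} = \begin{bmatrix} \mathbf{y} \\ \mathbf{y}_{\mathrm{u}}^{\ast} \end{bmatrix}$, $$L(\mathbf{w}_{\mathrm{semi}}, \mathbf{X}_{\mathrm{e}}, \mathbf{y}_{\mathrm{e}}^{\ast}) \le L(\mathbf{w}_{\mathrm{sup}}, \mathbf{X}_{\mathrm{e}}, \mathbf{y}_{\mathrm{e}}^{\ast}).$$
   Context: The quadratic loss is $L(\mathbf{w}, \mathbf{A}, \mathbf{b}) = \lVert \mathbf{A}\mathbf{w} - \mathbf{b} \rVert^2$, with the Euclidean norm, for a matrix $\mathbf{A} \in \mathbb{R}^{n\times d}$, a vector $\mathbf{b}\in\mathbb{R}^n$ and $\mathbf{w}\in\mathbb{R}^d$. The rows of $\mathbf{X}$ are the feature vectors of the labeled objects with labels $\mathbf{y}$. The rows of $\mathbf{X}_{\mathrm{u}}$ are the feature vectors of the unlabeled objects, whose true labels $\mathbf{y}_{\mathrm{u}}^{\ast}$ are unknown, so $\mathbf{w}_{\mathrm{semi}}$ does not depend on $\mathbf{y}_{\mathrm{u}}^{\ast}$. *)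

theory Defs
  imports "HOL-Analysis.Analysis"
begin

(* The vertical block [u; v], with blocks indexed by the two summands of 'l + 'u.
   A matrix is a vector of its rows, so the same operation stacks matrices
   (entries of type real ^ 'd) and column vectors (entries of type real). *)
definition vstack :: "'a ^ 'l \<Rightarrow> 'a ^ 'u \<Rightarrow> 'a ^ ('l + 'u)" where
  "vstack u v = (\<chi> i. case i of Inl j \<Rightarrow> u $ j | Inr k \<Rightarrow> v $ k)"

definition positive_definite :: "real ^ 'n ^ 'n \<Rightarrow> bool" where
  "positive_definite A \<longleftrightarrow>
     transpose A = A \<and> (\<forall>v. v \<noteq> 0 \<longrightarrow> 0 < v \<bullet> (A *v v))"

definition quadratic_loss :: "real ^ 'd \<Rightarrow> real ^ 'd ^ 'n \<Rightarrow> real ^ 'n \<Rightarrow> real" where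
  "quadratic_loss w A b = (norm (A *v w - b))\<^sup>2"

(* matrix_inv is meaningful only where transpose A ** A is invertible. *)
definition least_squares :: "real ^ 'd ^ 'n \<Rightarrow> real ^ 'n \<Rightarrow> real ^ 'd" where
  "least_squares A b = (matrix_inv (transpose A ** A) ** transpose A) *v b"

definition gram_dist :: "real ^ 'd ^ 'n \<Rightarrow> real ^ 'd \<Rightarrow> real ^ 'd \<Rightarrow> real" where
  "gram_dist A w w' = sqrt ((w - w') \<bullet> ((transpose A ** A) *v (w - w')))"

definition w_sup :: "real ^ 'd ^ 'l \<Rightarrow> real ^ 'l \<Rightarrow> real ^ 'd" where
  "w_sup X y = least_squares X y"

definition constraint_set ::
    "real ^ 'd ^ 'l \<Rightarrow> real ^ 'd ^ 'u \<Rightarrow> real ^ 'l \<Rightarrow> (real ^ 'd) set" where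
  "constraint_set X Xu y =
     {least_squares (vstack X Xu) (vstack y yu) | yu. \<forall>i. yu $ i \<in> {0..1}}"

(* A total function of the observed data: it carries information only once the minimizer is
   shown to exist and be unique, which is not assumed anywhere. *)
definition w_semi ::
    "real ^ 'd ^ 'l \<Rightarrow> real ^ 'd ^ 'u \<Rightarrow> real ^ 'l \<Rightarrow> real ^ 'd" where
  "w_semi X Xu y =
     (THE w. is_arg_min (\<lambda>v. gram_dist (vstack X Xu) v (w_sup X y))
               (\<lambda>v. v \<in> constraint_set X Xu y) w)"

end

theory Submission
  imports Defs
begin

text \<open>
  The Gram distance of $w$ and $w'$ is the Euclidean distance of their predictions $X_e w$ and
  $X_e w'$, so the predictions of the projected estimator are the metric projection of those of
  the supervised one onto a compact convex set. The oracle fit, computed from the true labels,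
  lies in $\Theta$ because these labels lie in $[0,1]$; metric projection therefore does not
  increase the distance to its predictions. By Pythagoras, the loss is the squared distance to
  the predictions of the oracle fit plus a constant.
\<close>

lemma gram_inner:
  fixes A :: "real ^ 'd ^ 'n"
  shows "v \<bullet> ((transpose A ** A) *v w) = (A *v v) \<bullet> (A *v w)"
proof -
  have "(transpose A ** A) *v w = (A *v w) v* A"
    by (simp flip: matrix_vector_mul_assoc)
  then show ?thesis
    by (simp add: inner_commute[of v] dot_lmul_matrix inner_commute[of "A *v w"])
qed

lemma gram_dist_eq_dist: "gram_dist A w w' = dist (A *v w) (A *v w')"
  by (simp only: gram_dist_def gram_inner)
    (simp add: dist_norm norm_eq_sqrt_inner matrix_vector_mult_diff_distrib)

text \<open>Predictions determine weights: a difference \<open>v - w\<close> in the kernel of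
  \<open>A\<close> would have zero quadratic form. This later makes the minimizer in
  \<open>w_semi\<close> unique.\<close>

lemma positive_definite_gram_inj:
  assumes "positive_definite (transpose A ** A)"
  shows "inj ((*v) A)"
proof (rule injI)
  fix v w assume "A *v v = A *v w"
  then have "(v - w) \<bullet> ((transpose A ** A) *v (v - w)) = 0"
    by (simp only: gram_inner) (simp add: matrix_vector_mult_diff_distrib)
  with assms show "v = w"
    unfolding positive_definite_def by (metis less_irrefl right_minus_eq)
qed

lemma positive_definite_invertible:
  assumes "positive_definite A"
  shows "invertible A"
proof -
  have "v = 0" if "A *v v = 0" for v
    using assms that unfolding positive_definite_def by (metis inner_zero_right less_irrefl)
  then show ?thesis
    using invertible_left_inverse matrix_left_invertible_ker by blast
qed

lemma least_squares_normal_equation: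
  assumes "invertible (transpose A ** A)"
  shows "(transpose A ** A) *v least_squares A b = transpose A *v b"
proof -
  have "(transpose A ** A) *v least_squares A b
      = ((transpose A ** A) ** matrix_inv (transpose A ** A)) *v (transpose A *v b)"
    unfolding least_squares_def by (simp only: matrix_vector_mul_assoc matrix_mul_assoc)
  also have "\<dots> = transpose A *v b"
    \<comment> \<open>\<open>matrix_inv\<close> is a Hilbert choice, so its inverse property comes
      from the existence of an inverse.\<close>
    using someI_ex[OF assms[unfolded invertible_def]] by (simp add: matrix_inv_def)
  finally show ?thesis .
qed

text \<open>The normal equations make the residual of the least squares fit orthogonal to the range
  of \<open>A\<close>.\<close>

lemma quadratic_loss_pythagoras:
  assumes "invertible (transpose A ** A)"
  shows "quadratic_loss w A b
       = (dist (A *v w) (A *v least_squares A b))\<^sup>2 + quadratic_loss (least_squares A b) A b"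
proof -
  let ?r = "A *v least_squares A b - b"
  have "transpose A *v ?r = 0"
    using least_squares_normal_equation[OF assms, of b]
    unfolding matrix_vector_mult_diff_distrib matrix_vector_mul_assoc by simp
  then have "(A *v (w - least_squares A b)) \<bullet> ?r = 0"
    by (simp add: inner_commute[of _ ?r] flip: dot_lmul_matrix)
  then have "orthogonal (A *v w - A *v least_squares A b) ?r"
    unfolding orthogonal_def matrix_vector_mult_diff_distrib .
  from norm_add_Pythagorean[OF this] show ?thesis
    by (simp add: quadratic_loss_def dist_norm)
qed

lemma linear_vstack_zero: "linear (vstack (0 :: real ^ 'l))"
  by (rule linearI) (auto simp: vstack_def vec_eq_iff split: sum.split)

text \<open>Separates the fixed labels from the free ones, so that fitted values become affine in
  the free labels.\<close>

lemma vstack_eq_add: "vstack (u :: real ^ 'l) v = vstack u 0 + vstack 0 v"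
  by (auto simp: vstack_def vec_eq_iff split: sum.split)

text \<open>The set of predictions is a translate of a linear image of the unit cube of soft labels,
  hence inherits its compactness and convexity.\<close>

lemma fitted_constraint_set:
  fixes X :: "real ^ 'd ^ 'l" and Xu :: "real ^ 'd ^ 'u"
  defines "E \<equiv> vstack X Xu"
  shows "compact ((*v) E ` constraint_set X Xu y)"
    and "convex ((*v) E ` constraint_set X Xu y)"
    and "(*v) E ` constraint_set X Xu y \<noteq> {}"
proof -
  \<comment> \<open>The hat matrix, sending labels to fitted values.\<close>
  define H where "H = E ** (matrix_inv (transpose E ** E) ** transpose E)"
  define g where "g yu = H *v vstack 0 yu" for yu :: "real ^ 'u"
  define Box where "Box = cbox (0 :: real ^ 'u) 1"
  have lin: "linear g"
    using linear_compose[OF linear_vstack_zero matrix_vector_mul_linear]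
    by (simp add: g_def[abs_def] o_def)
  have box: "yu \<in> Box \<longleftrightarrow> (\<forall>i. yu $ i \<in> {0..1})" for yu
    by (auto simp: Box_def mem_box_cart)
  have "E *v least_squares E (vstack y yu) = H *v vstack y 0 + g yu" for yu :: "real ^ 'u"
    unfolding H_def g_def least_squares_def matrix_vector_mul_assoc
    by (subst vstack_eq_add) (rule matrix_vector_right_distrib)
  then have fit: "(\<lambda>yu. E *v least_squares E (vstack y yu)) = (\<lambda>yu. H *v vstack y 0 + g yu)"
    by (rule ext)
  have "constraint_set X Xu y = (\<lambda>yu. least_squares E (vstack y yu)) ` Box"
    unfolding constraint_set_def E_def[symmetric] box[symmetric] by blast
  then have eq: "(*v) E ` constraint_set X Xu y = (+) (H *v vstack y 0) ` g ` Box"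
    by (simp only: image_image fit)
  show "compact ((*v) E ` constraint_set X Xu y)"
    unfolding eq using lin
    by (intro compact_translation compact_continuous_image linear_continuous_on)
      (auto simp: Box_def linear_linear)
  show "convex ((*v) E ` constraint_set X Xu y)"
    unfolding eq using lin
    by (intro convex_translation convex_linear_image) (auto simp: Box_def)
  have "0 \<in> Box" by (simp add: box)
  then show "(*v) E ` constraint_set X Xu y \<noteq> {}"
    unfolding eq by blast
qed

text \<open>Here the definite description in \<open>w_semi\<close> is justified: closedness and
  nonemptiness give a nearest prediction, convexity makes it unique, and injectivity of
  \<open>E\<close> carries both back to the weights.\<close>

lemma fitted_w_semi:
  fixes X :: "real ^ 'd ^ 'l" and Xu :: "real ^ 'd ^ 'u"
  defines "E \<equiv> vstack X Xu"
  assumes inj: "inj ((*v) E)"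
  shows "E *v w_semi X Xu y = closest_point ((*v) E ` constraint_set X Xu y) (E *v w_sup X y)"
proof -
  let ?K = "(*v) E ` constraint_set X Xu y"
  let ?s = "E *v w_sup X y"
  note K = fitted_constraint_set[of X Xu y, folded E_def]
  have cl: "closed ?K" using K(1) by (rule compact_imp_closed)
  have min: "is_arg_min (\<lambda>v. gram_dist E v (w_sup X y)) (\<lambda>v. v \<in> constraint_set X Xu y) w
      \<longleftrightarrow> E *v w = closest_point ?K ?s" (is "?min w \<longleftrightarrow> _") for w
  proof
    assume "?min w"
    then have "E *v w \<in> ?K" "\<forall>z\<in>?K. dist ?s (E *v w) \<le> dist ?s z"
      by (auto simp: is_arg_min_linorder gram_dist_eq_dist dist_commute)
    then show "E *v w = closest_point ?K ?s"
      using closest_point_unique[OF K(2) cl] by blast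
  next
    assume w: "E *v w = closest_point ?K ?s"
    have "E *v w \<in> ?K" using closest_point_in_set[OF cl K(3)] w by simp
    then have "w \<in> constraint_set X Xu y" using inj by (simp add: inj_image_mem_iff)
    moreover have "\<forall>z\<in>?K. dist ?s (E *v w) \<le> dist ?s z"
      using closest_point_le[OF cl] w by simp
    ultimately show "?min w"
      by (auto simp: is_arg_min_linorder gram_dist_eq_dist dist_commute)
  qed
  obtain w where w: "E *v w = closest_point ?K ?s"
    using closest_point_in_set[OF cl K(3), of ?s] by (metis imageE)
  \<comment> \<open>After rewriting, the description asks for the only weight vector with the same
    predictions as \<open>w\<close>.\<close>
  have "w_semi X Xu y = w"
    unfolding w_semi_def E_def[symmetric] min w[symmetric] using inj
    by (simp add: inj_eq)
  with w show ?thesis by simp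
qed

theorem theorem1:
  fixes X :: "real ^ 'd ^ 'l" and Xu :: "real ^ 'd ^ 'u"
    and y :: "real ^ 'l" and yu_true :: "real ^ 'u"
  assumes "\<forall>i. y $ i \<in> {0, 1}"
    and "positive_definite (transpose (vstack X Xu) ** vstack X Xu)"
    and "invertible (transpose X ** X)"
    and "\<forall>i. yu_true $ i \<in> {0, 1}"
  shows "quadratic_loss (w_semi X Xu y) (vstack X Xu) (vstack y yu_true)
       \<le> quadratic_loss (w_sup X y) (vstack X Xu) (vstack y yu_true)"
proof -
  define E where "E = vstack X Xu"
  define K where "K = (*v) E ` constraint_set X Xu y"
  define w where "w = least_squares E (vstack y yu_true)"
  note K = fitted_constraint_set[of X Xu y, folded E_def, folded K_def]
  have cl: "closed K" using K(1) by (rule compact_imp_closed)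
  have "yu_true $ i \<in> {0..1}" for i
    using spec[OF assms(4), of i] by auto
  then have "w \<in> constraint_set X Xu y"
    unfolding constraint_set_def w_def E_def by blast
  then have "closest_point K (E *v w) = E *v w"
    unfolding K_def by (intro closest_point_self imageI)
  moreover have "E *v w_semi X Xu y = closest_point K (E *v w_sup X y)"
    using fitted_w_semi[OF positive_definite_gram_inj[OF assms(2)]] by (simp add: K_def E_def)
  \<comment> \<open>Projection onto \<open>K\<close> is 1-Lipschitz and fixes the oracle prediction
    \<open>E *v w\<close>.\<close>
  ultimately have "dist (E *v w_semi X Xu y) (E *v w) \<le> dist (E *v w_sup X y) (E *v w)"
    using closest_point_lipschitz[OF K(2) cl K(3)] by metis
  then have "(dist (E *v w_semi X Xu y) (E *v w))\<^sup>2 \<le> (dist (E *v w_sup X y) (E *v w))\<^sup>2"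
    by (simp add: power_mono)
  moreover have "quadratic_loss v E (vstack y yu_true)
      = (dist (E *v v) (E *v w))\<^sup>2 + quadratic_loss w E (vstack y yu_true)" for v
    using positive_definite_invertible[OF assms(2)]
    unfolding w_def E_def by (rule quadratic_loss_pythagoras)
  ultimately show ?thesis
    unfolding E_def[symmetric] by (metis add_right_mono)
qed

end
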